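(* For every $k\ge1$, $l\in\mathbb Z_{\ge0}$ and $\mathbf n=(n_1,\dots,n_k)\in\mathbb Z_{\ge0}^k$, $$Z^{(k)}_{l;\mathbf n}(\mathbf u)=\frac{\mathcal Q_1(\mathbf u)\,\mathcal Q_k(\mathbf u)^{l+1}}{\mathcal Q_{k+1}(\mathbf u)^{l+1}}\prod_{i=1}^k\frac{\mathcal Q_i(\mathbf u)^{n_i}}{u_i}.$$
   Context: Formal variables $\mathbf u=(u;u_1,u_2,\dots)$. The functions $\mathcal Q_k(\mathbf u)=\mathcal Q_k(u;u_1,\dots,u_{k-1})$ are defined by $\mathcal Q_0=1$, $\mathcal Q_1=u^{-1}$, $\mathcal Q_{k+1}=\dfrac{\mathcal Q_k^2-1}{u_k\mathcal Q_{k-1}}$ for $k\ge1$. The generating function is $$Z^{(k)}_{l;\mathbf n}(\mathbf u)=\sum_{\mathbf m\in\mathbb Z_{\ge0}^k}u^q\prod_{i=1}^k\binom{m_i+q_i}{m_i}u_i^{q_i},\qquad q=l+\sum_{j=1}^kj(2m_j-n_j),\quad q_i=l+\sum_{j=1}^{k-i}j(2m_{i+j}-n_{i+j}),$$ with $\binom{m+p}{m}=\frac{(p+m)\cdots(p+1)}{m!}$ for all $p\in\mathbb Z$. It is a Laurent series in $u$ with coefficients Laurent polynomials in the $u_i$; the right-hand side, a rational function, is expanded as a Laurent series in $u$ (around $u=0$). *)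

theory Defs
  imports
    "HOL-Analysis.Infinite_Sum"
    "HOL-Computational_Algebra.Computational_Algebra"
    "HOL-Library.Poly_Mapping"
begin

section \<open>The field of rational functions\<close>

instance fract :: ("{idom, ring_char_0}") field_char_0
proof
  have "of_nat n = (Fract (of_nat n) 1 :: 'a fract)" for n
    by (induction n) (simp_all add: Zero_fract_def One_fract_def)
  then show "inj (of_nat :: nat \<Rightarrow> 'a fract)"
    by (auto intro!: injI simp: eq_fract)
qed

text \<open>
  The field \<open>K(u\<^sub>1, u\<^sub>2, \<dots>)\<close> is the fraction field of the ring of polynomials over \<open>K\<close>, realised
  as the monoid ring of the finitely supported exponent vectors \<open>nat \<Rightarrow>\<^sub>0 nat\<close>. Indexing starts
  at 0, so there is one additional variable, with index 0, which is never used.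
\<close>

type_synonym 'a ratfun' = "((nat \<Rightarrow>\<^sub>0 nat) \<Rightarrow>\<^sub>0 'a) fract"

text \<open>The field \<open>K(u; u\<^sub>1, u\<^sub>2, \<dots>)\<close>, as rational functions in \<open>u\<close> over \<open>K(u\<^sub>1, u\<^sub>2, \<dots>)\<close>.\<close>

type_synonym 'a ratfun = "'a ratfun' poly fract"

definition var' :: "nat \<Rightarrow> 'a::field_char_0 ratfun'" where
  "var' i = Fract (Poly_Mapping.single (Poly_Mapping.single i 1) 1) 1"

definition var_u :: "'a::field_char_0 ratfun" where
  "var_u = Fract [:0, 1:] 1"

definition var :: "nat \<Rightarrow> 'a::field_char_0 ratfun" where
  "var i = Fract [:var' i:] 1"

fun Q :: "nat \<Rightarrow> 'a::field_char_0 ratfun" where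
  "Q 0 = 1"
| "Q (Suc 0) = inverse var_u"
| "Q (Suc (Suc k)) = ((Q (Suc k))\<^sup>2 - 1) / (var (Suc k) * Q k)"


section \<open>Expansion of rational functions around \<open>u = 0\<close>\<close>

definition laurent :: "'b::field poly fract \<Rightarrow> 'b fls" where
  "laurent r = (THE f. \<forall>p q. q \<noteq> 0 \<and> r = Fract p q \<longrightarrow>
     f = fps_to_fls (fps_of_poly p) / fps_to_fls (fps_of_poly q))"

lemma laurent_Fract:
  assumes "q \<noteq> 0"
  shows "laurent (Fract p q) = fps_to_fls (fps_of_poly p) / fps_to_fls (fps_of_poly q)"
  unfolding laurent_def
proof (rule the_equality)
  show "\<forall>p' q'. q' \<noteq> 0 \<and> Fract p q = Fract p' q' \<longrightarrow>
      fps_to_fls (fps_of_poly p) / fps_to_fls (fps_of_poly q) =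
      fps_to_fls (fps_of_poly p') / fps_to_fls (fps_of_poly q')"
  proof (intro allI impI, elim conjE)
    fix p' q' :: "'a poly"
    assume q': "q' \<noteq> 0" and "Fract p q = Fract p' q'"
    with assms have "p * q' = p' * q" by (simp add: eq_fract)
    then have "fps_to_fls (fps_of_poly p) * fps_to_fls (fps_of_poly q') =
        fps_to_fls (fps_of_poly p') * fps_to_fls (fps_of_poly q)"
      by (metis fps_of_poly_mult fls_times_fps_to_fls)
    moreover from assms q' have "fps_of_poly q \<noteq> 0" "fps_of_poly q' \<noteq> 0"
      by (metis fps_of_poly_0 fps_of_poly_eq_iff)+
    ultimately show "fps_to_fls (fps_of_poly p) / fps_to_fls (fps_of_poly q) =
        fps_to_fls (fps_of_poly p') / fps_to_fls (fps_of_poly q')"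
      by (simp add: frac_eq_eq)
  qed
next
  fix f
  assume "\<forall>p' q'. q' \<noteq> 0 \<and> Fract p q = Fract p' q' \<longrightarrow>
      f = fps_to_fls (fps_of_poly p') / fps_to_fls (fps_of_poly q')"
  from this[rule_format, of q p] assms
  show "f = fps_to_fls (fps_of_poly p) / fps_to_fls (fps_of_poly q)" by simp
qed

lemma laurent_var_u: "laurent var_u = fls_X"
  by (simp add: var_u_def laurent_Fract)

lemma laurent_var: "laurent (var i) = fls_const (var' i)"
  by (simp add: var_def laurent_Fract fps_of_poly_const)

lemma laurent_1: "laurent 1 = 1"
  by (simp add: One_fract_def laurent_Fract)

lemma laurent_mult: "laurent (x * y) = laurent x * laurent y"
  by (cases x, cases y) (simp add: laurent_Fract fps_of_poly_mult fls_times_fps_to_fls)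

lemma laurent_add: "laurent (x + y) = laurent x + laurent y"
proof (cases x, cases y)
  fix a b c d :: "'a poly"
  assume x: "x = Fract a b" "b \<noteq> 0" and y: "y = Fract c d" "d \<noteq> 0"
  then have "fps_of_poly b \<noteq> 0" "fps_of_poly d \<noteq> 0"
    by (metis fps_of_poly_0 fps_of_poly_eq_iff)+
  with x y show ?thesis
    by (simp add: laurent_Fract fps_of_poly_mult fps_of_poly_add fls_times_fps_to_fls
        add_frac_eq)
qed


section \<open>The generating function\<close>

text \<open>
  \<open>qexp k l n m i\<close> is \<open>q\<^sub>i\<close>; for \<open>i = 0\<close> the same formula gives \<open>q\<close>. Only the values of \<open>n\<close> and \<open>m\<close>
  on \<open>{1..k}\<close> matter.
\<close>

definition qexp :: "nat \<Rightarrow> nat \<Rightarrow> (nat \<Rightarrow> nat) \<Rightarrow> (nat \<Rightarrow> nat) \<Rightarrow> nat \<Rightarrow> int" where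
  "qexp k l n m i = int l + (\<Sum>j=1..k-i. int j * (2 * int (m (i + j)) - int (n (i + j))))"

text \<open>
  With \<open>x = m + p\<close>, \<open>x gchoose m\<close> is \<open>(p + m) \<cdots> (p + 1) / m!\<close>, for negative \<open>p\<close> as well.
\<close>

definition gen_term ::
    "nat \<Rightarrow> nat \<Rightarrow> (nat \<Rightarrow> nat) \<Rightarrow> (nat \<Rightarrow> nat) \<Rightarrow> 'a::field_char_0 ratfun' fls" where
  "gen_term k l n m = fls_X powi qexp k l n m 0 *
     (\<Prod>i=1..k. (of_int (int (m i) + qexp k l n m i) gchoose m i) *
        fls_const (var' i) powi qexp k l n m i)"

text \<open>
  The sum is taken in the \<open>u\<close>-adic topology; each power of \<open>u\<close> receives finitely many contributions,
  see \<open>gen_term_summable\<close> and \<open>fls_nth_Z\<close> below. The index set is the set of all vectors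
  \<open>(m\<^sub>1, \<dots>, m\<^sub>k)\<close> of natural numbers.
\<close>

definition Z :: "nat \<Rightarrow> nat \<Rightarrow> (nat \<Rightarrow> nat) \<Rightarrow> 'a::field_char_0 ratfun' fls" where
  "Z k l n = (\<Sum>\<^sub>\<infinity>m \<in> {1..k} \<rightarrow>\<^sub>E UNIV. gen_term k l n m)"

definition gen_coeff ::
    "nat \<Rightarrow> nat \<Rightarrow> (nat \<Rightarrow> nat) \<Rightarrow> (nat \<Rightarrow> nat) \<Rightarrow> 'a::field_char_0 ratfun'" where
  "gen_coeff k l n m =
     (\<Prod>i=1..k. (of_int (int (m i) + qexp k l n m i) gchoose m i) * var' i powi qexp k l n m i)"

lemma fls_const_gbinomial:
  "(of_int a gchoose j :: 'b::field_char_0 fls) = fls_const (of_int a gchoose j)"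
proof -
  have prd: "(\<Prod>i\<in>A. fls_const (f i)) = fls_const (\<Prod>i\<in>A. f i :: 'b)" for f and A :: "nat set"
    by (induction A rule: infinite_finite_induct) simp_all
  have "fact j * (of_int a gchoose j :: 'b fls) = (\<Prod>i=0..<j. fls_const (of_int a - of_nat i))"
    by (simp add: gbinomial_mult_fact fls_of_int fls_of_nat fls_minus_const)
  also have "\<dots> = fls_const (fact j * (of_int a gchoose j))"
    by (simp only: prd gbinomial_mult_fact)
  also have "\<dots> = fact j * fls_const (of_int a gchoose j)"
    by (metis fls_const_mult_const fls_of_nat of_nat_fact)
  finally show ?thesis by simp
qed

lemma gen_term_eq: "gen_term k l n m = fls_X powi qexp k l n m 0 * fls_const (gen_coeff k l n m)"
proof -
  have "(\<Prod>i\<in>A. fls_const (f i)) = fls_const (\<Prod>i\<in>A. f i :: 'b::comm_ring_1)"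
    for f and A :: "nat set"
    by (induction A rule: infinite_finite_induct) simp_all
  then show ?thesis
    by (simp add: gen_term_def gen_coeff_def fls_const_gbinomial
        fls_const_power_int[symmetric] del: fls_X_power_int of_int_add)
qed

lemma fls_nth_gen_term:
  "fls_nth (gen_term k l n m) N = (if qexp k l n m 0 = N then gen_coeff k l n m else 0)"
  by (auto simp: gen_term_eq fls_X_intpow_times_conv_shift)

lemma finite_qexp_le: "finite {m \<in> {1..k} \<rightarrow>\<^sub>E UNIV. qexp k l n m 0 \<le> N}"
proof (rule finite_subset)
  define B where "B = nat (N + (\<Sum>j=1..k. int j * int (n j)))"
  show "finite ({1..k} \<rightarrow>\<^sub>E {..B})" by (intro finite_PiE) auto
  show "{m \<in> {1..k} \<rightarrow>\<^sub>E UNIV. qexp k l n m 0 \<le> N} \<subseteq> {1..k} \<rightarrow>\<^sub>E {..B}"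
  proof
    fix m assume "m \<in> {m \<in> {1..k} \<rightarrow>\<^sub>E (UNIV :: nat set). qexp k l n m 0 \<le> N}"
    then have m: "m \<in> {1..k} \<rightarrow>\<^sub>E (UNIV :: nat set)" and le: "qexp k l n m 0 \<le> N"
      by auto
    have "m i \<le> B" if i: "i \<in> {1..k}" for i
    proof -
      have "int (m i) \<le> int i * (2 * int (m i))"
        using i mult_mono[of 1 "int i" "int (m i)" "2 * int (m i)"] by simp
      also have "\<dots> \<le> (\<Sum>j=1..k. int j * (2 * int (m j)))"
        using i by (intro member_le_sum[where f = "\<lambda>j. int j * (2 * int (m j))"]) auto
      also have "\<dots> = qexp k l n m 0 - int l + (\<Sum>j=1..k. int j * int (n j))"
        by (simp add: qexp_def right_diff_distrib sum_subtractf)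
      finally show ?thesis using le by (simp add: B_def)
    qed
    with m show "m \<in> {1..k} \<rightarrow>\<^sub>E {..B}" by (auto simp: PiE_iff)
  qed
qed

lemma gen_term_has_sum:
  obtains S :: "'a::field_char_0 ratfun' fls"
  where "(gen_term k l n has_sum S) ({1..k} \<rightarrow>\<^sub>E UNIV)"
    and "\<And>N. fls_nth S N =
           (\<Sum>m | m \<in> {1..k} \<rightarrow>\<^sub>E UNIV \<and> qexp k l n m 0 = N. gen_coeff k l n m)"
proof -
  let ?M = "{1..k} \<rightarrow>\<^sub>E (UNIV :: nat set)"
  define c :: "int \<Rightarrow> 'a ratfun'"
    where "c N = (\<Sum>m | m \<in> ?M \<and> qexp k l n m 0 = N. gen_coeff k l n m)" for N
  define L where "L = - (\<Sum>j=1..k. int j * int (n j))"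
  have "L \<le> qexp k l n m 0" for m
    by (simp add: L_def qexp_def right_diff_distrib sum_subtractf sum_nonneg)
  then have "c N = 0" if "N < L" for N
    unfolding c_def using that by (intro sum.neutral) (auto simp: not_less[symmetric])
  then have nth: "fls_nth (Abs_fls c) N = c N" for N
    by (intro nth_Abs_fls_lower_bound[of L]) auto
  have "(gen_term k l n has_sum Abs_fls c) ?M"
    unfolding has_sum_def
  proof (rule tendstoI)
    fix e :: real assume "0 < e"
    then obtain N :: nat where N: "inverse (2 ^ N) < e"
      using real_arch_pow_inv[of e "1/2"] by (auto simp: field_simps power_divide)
    let ?A = "{m \<in> ?M. qexp k l n m 0 \<le> int N}"
    have "dist (sum (gen_term k l n) F) (Abs_fls c) < e"
      if F: "finite F" "?A \<subseteq> F" "F \<subseteq> ?M" for F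
    proof (cases "sum (gen_term k l n) F = Abs_fls c")
      case False
      have "fls_nth (sum (gen_term k l n) F - Abs_fls c) i = 0" if "i < int N" for i
      proof -
        have "fls_nth (sum (gen_term k l n) F) i =
            (\<Sum>m\<in>F. if qexp k l n m 0 = i then gen_coeff k l n m else 0)"
          by (simp add: fls_nth_sum fls_nth_gen_term)
        also have "\<dots> = (\<Sum>m | m \<in> F \<and> qexp k l n m 0 = i. gen_coeff k l n m)"
          using F(1) by (simp add: sum.inter_filter)
        also have "{m. m \<in> F \<and> qexp k l n m 0 = i} = {m. m \<in> ?M \<and> qexp k l n m 0 = i}"
          using F(2,3) that by force
        finally show ?thesis by (simp add: nth c_def)
      qed
      then have "int N \<le> fls_subdegree (sum (gen_term k l n) F - Abs_fls c)"
        using False by (intro fls_subdegree_geI) auto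
      then have "dist (sum (gen_term k l n) F) (Abs_fls c) \<le> inverse (2 ^ N)"
        using False by (auto simp: dist_fls_def intro!: le_imp_inverse_le power_increasing)
      with N show ?thesis by simp
    qed (use \<open>0 < e\<close> in simp)
    then show "\<forall>\<^sub>F F in finite_subsets_at_top ?M. dist (sum (gen_term k l n) F) (Abs_fls c) < e"
      unfolding eventually_finite_subsets_at_top
      using finite_qexp_le by (intro exI[of _ ?A]) auto
  qed
  with nth show ?thesis by (intro that) (auto simp: c_def)
qed

lemma gen_term_summable: "gen_term k l n summable_on ({1..k} \<rightarrow>\<^sub>E UNIV)"
  by (rule gen_term_has_sum) (rule has_sum_imp_summable)

lemma fls_nth_Z:
  "fls_nth (Z k l n :: 'a::field_char_0 ratfun' fls) N =
     (\<Sum>m | m \<in> {1..k} \<rightarrow>\<^sub>E UNIV \<and> qexp k l n m 0 = N. gen_coeff k l n m)"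
proof -
  obtain S :: "'a ratfun' fls" where "(gen_term k l n has_sum S) ({1..k} \<rightarrow>\<^sub>E UNIV)"
    and nth: "\<And>N. fls_nth S N =
      (\<Sum>m | m \<in> {1..k} \<rightarrow>\<^sub>E UNIV \<and> qexp k l n m 0 = N. gen_coeff k l n m)"
    by (rule gen_term_has_sum[of k l n]) (erule that, simp only:)
  then have "Z k l n = S" by (simp only: Z_def infsumI)
  with nth show ?thesis by simp
qed

end

theory Submission
  imports Defs "HOL-Analysis.Elementary_Metric_Spaces"
begin

text \<open>
  The exponents satisfy \<open>q\<^sub>j = 2 q\<^sub>j\<^sub>+\<^sub>1 - q\<^sub>j\<^sub>+\<^sub>2 + 2 m\<^sub>j\<^sub>+\<^sub>1 - n\<^sub>j\<^sub>+\<^sub>1\<close>, and \<open>q\<^sub>i\<close> does not involve \<open>m\<^sub>1, \<dots>, m\<^sub>i\<close>.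
  Hence the sum over \<open>m\<^sub>1\<close> is a binomial series in \<open>u\<^sup>2 = Q\<^sub>1\<^sup>-\<^sup>2\<close>, with sum \<open>(1 - u\<^sup>2)\<close> to the power
  \<open>- q\<^sub>1 - 1\<close>, and \<open>1 - Q\<^sub>1\<^sup>-\<^sup>2\<close> is a Laurent monomial in \<open>Q\<^sub>0, Q\<^sub>1, Q\<^sub>2, u\<^sub>1\<close> by the recursion. What remains is
  a sum of the same shape with \<open>(Q\<^sub>0, Q\<^sub>1)\<close> replaced by \<open>(Q\<^sub>1, Q\<^sub>2)\<close>, times a prefactor. Repeating
  this, \<open>m\<^sub>j\<^sub>+\<^sub>1\<close> is summed by a binomial series in \<open>Q\<^sub>j\<^sub>+\<^sub>1\<^sup>-\<^sup>2\<close>, which converges since \<open>Q\<^sub>i\<close> has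
  \<open>u\<close>-order \<open>- i\<close>, and the prefactors telescope.
\<close>

section \<open>Convergence of formal Laurent series\<close>

text \<open>\<open>dist\<close> is 2 to the power of minus the order of the difference, so a small
  ball fixes all coefficients below a bound.\<close>

lemma tendsto_fls_iff:
  fixes f :: "'b \<Rightarrow> 'a::ab_group_add fls"
  shows "(f \<longlongrightarrow> L) F \<longleftrightarrow> (\<forall>N. \<forall>\<^sub>F x in F. \<forall>i<int N. fls_nth (f x) i = fls_nth L i)"
proof
  assume lim: "(f \<longlongrightarrow> L) F"
  show "\<forall>N. \<forall>\<^sub>F x in F. \<forall>i<int N. fls_nth (f x) i = fls_nth L i"
  proof
    fix N
    have "\<forall>\<^sub>F x in F. dist (f x) L < inverse (2 ^ N)"
      using lim by (rule tendstoD) simp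
    then show "\<forall>\<^sub>F x in F. \<forall>i<int N. fls_nth (f x) i = fls_nth L i"
    proof (rule eventually_mono, intro allI impI)
      fix x i assume d: "dist (f x) L < inverse (2 ^ N)" and i: "i < int N"
      show "fls_nth (f x) i = fls_nth L i"
      proof (cases "f x = L")
        case False
        have "int N \<le> fls_subdegree (f x - L)"
        proof (rule ccontr)
          assume less: "\<not> int N \<le> fls_subdegree (f x - L)"
          have "inverse (2 ^ N) \<le> dist (f x) L"
          proof (cases "fls_subdegree (f x - L) \<ge> 0")
            case True
            then show ?thesis using False less
              by (auto simp: dist_fls_def intro!: le_imp_inverse_le power_increasing)
          next
            case neg: False
            have "inverse (2 ^ N) \<le> (1::real)" by (simp add: inverse_le_1_iff)
            also have "\<dots> \<le> dist (f x) L" using False neg by (simp add: dist_fls_def)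
            finally show ?thesis .
          qed
          with d show False by simp
        qed
        with i have "fls_nth (f x - L) i = 0" by (intro fls_eq0_below_subdegree) simp
        then show ?thesis by simp
      qed simp
    qed
  qed
next
  assume *: "\<forall>N. \<forall>\<^sub>F x in F. \<forall>i<int N. fls_nth (f x) i = fls_nth L i"
  show "(f \<longlongrightarrow> L) F"
  proof (rule tendstoI)
    fix e :: real assume "0 < e"
    then obtain N :: nat where N: "inverse (2 ^ N) < e"
      using real_arch_pow_inv[of e "1/2"] by (auto simp: field_simps power_divide)
    from *[rule_format, of N] show "\<forall>\<^sub>F x in F. dist (f x) L < e"
    proof (rule eventually_mono)
      fix x assume x: "\<forall>i<int N. fls_nth (f x) i = fls_nth L i"
      show "dist (f x) L < e"
      proof (cases "f x = L")
        case False
        with x have "int N \<le> fls_subdegree (f x - L)"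
          by (intro fls_subdegree_geI) auto
        then have "dist (f x) L \<le> inverse (2 ^ N)"
          using False by (auto simp: dist_fls_def intro!: le_imp_inverse_le power_increasing)
        with N show ?thesis by simp
      qed (use \<open>0 < e\<close> in simp)
    qed
  qed
qed

text \<open>Continuity of addition is what \<open>has_sum_SigmaD\<close> requires for iterated
  summation. It holds because each coefficient of a sum depends only on the same coefficient of the
  summands.\<close>

instance fls :: (ab_group_add) topological_comm_monoid_add
proof
  fix a b :: "'a fls"
  show "((\<lambda>x. fst x + snd x) \<longlongrightarrow> a + b) (nhds a \<times>\<^sub>F nhds b)"
    unfolding tendsto_fls_iff
  proof
    fix N
    have ev: "\<forall>\<^sub>F x in nhds c. \<forall>i<int N. fls_nth x i = fls_nth c i" for c :: "'a fls"
      using filterlim_ident[of "nhds c"] unfolding tendsto_fls_iff by blast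
    show "\<forall>\<^sub>F x in nhds a \<times>\<^sub>F nhds b. \<forall>i<int N. fls_nth (fst x + snd x) i = fls_nth (a + b) i"
      unfolding eventually_prod_filter using ev[of a] ev[of b] by fastforce
  qed
qed

lemma has_sum_fls_cmult:
  fixes c :: "'a::field fls"
  assumes "(f has_sum S) A"
  shows "((\<lambda>x. c * f x) has_sum (c * S)) A"
proof (cases "c = 0")
  case False
  show ?thesis unfolding has_sum_def tendsto_fls_iff
  proof
    fix N
    \<comment> \<open>Multiplication by \<open>c\<close> shifts orders by
      \<open>fls_subdegree c\<close>, so agreement below \<open>M\<close> before it gives agreement
      below \<open>N\<close> after it.\<close>
    define M where "M = nat (int N - fls_subdegree c)"
    have "\<forall>\<^sub>F F in finite_subsets_at_top A. \<forall>i<int M. fls_nth (sum f F) i = fls_nth S i"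
      using assms unfolding has_sum_def tendsto_fls_iff by blast
    then show "\<forall>\<^sub>F F in finite_subsets_at_top A.
        \<forall>i<int N. fls_nth (\<Sum>x\<in>F. c * f x) i = fls_nth (c * S) i"
    proof (rule eventually_mono, intro allI impI)
      fix F i
      assume F: "\<forall>i<int M. fls_nth (sum f F) i = fls_nth S i" and i: "i < int N"
      have "fls_nth (c * (sum f F - S)) i = 0"
      proof (cases "sum f F = S")
        case neq: False
        with F have "int M \<le> fls_subdegree (sum f F - S)"
          by (intro fls_subdegree_geI) auto
        with i False neq show ?thesis
          by (intro fls_eq0_below_subdegree) (simp add: M_def split: if_splits)
      qed simp
      then show "fls_nth (\<Sum>x\<in>F. c * f x) i = fls_nth (c * S) i"
        by (simp add: sum_distrib_left right_diff_distrib)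
    qed
  qed
qed simp

section \<open>Binomial series in a Laurent series of positive order\<close>

text \<open>Coefficients of \<open>y ^ m\<close> below index \<open>m\<close> vanish, so every
  finite index set containing \<open>{..N}\<close> already yields the coefficients below
  \<open>N\<close>.\<close>

lemma has_sum_fps_compose:
  fixes a y :: "'a::field fps"
  assumes "fps_nth y 0 = 0"
  shows "((\<lambda>m. fls_const (fps_nth a m) * fps_to_fls y ^ m) has_sum fps_to_fls (a oo y)) UNIV"
  unfolding has_sum_def tendsto_fls_iff eventually_finite_subsets_at_top
proof (intro allI exI conjI impI)
  fix N i
  fix F :: "nat set"
  assume F: "finite F \<and> {..N} \<subseteq> F \<and> F \<subseteq> UNIV" and i: "i < int N"
  show "fls_nth (\<Sum>m\<in>F. fls_const (fps_nth a m) * fps_to_fls y ^ m) i =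
      fls_nth (fps_to_fls (a oo y)) i"
  proof (cases "i < 0")
    case True
    then show ?thesis by (simp add: fls_nth_sum fps_to_fls_power[symmetric])
  next
    case False
    then have "fls_nth (\<Sum>m\<in>F. fls_const (fps_nth a m) * fps_to_fls y ^ m) i =
        (\<Sum>m\<in>F. fps_nth a m * fps_nth (y ^ m) (nat i))"
      by (simp add: fls_nth_sum fps_to_fls_power[symmetric])
    also have "\<dots> = (\<Sum>m=0..nat i. fps_nth a m * fps_nth (y ^ m) (nat i))"
      using F i assms by (intro sum.mono_neutral_right) (auto simp: startsby_zero_power_prefix)
    finally show ?thesis using False by (simp add: fps_compose_nth)
  qed
qed simp_all

text \<open>For \<open>e \<ge> 0\<close> the binomial series is a power of \<open>1 + X\<close>; for
  negative \<open>e\<close>, additivity in the exponent makes it the inverse of one.\<close>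

lemma fps_compose_binomial_of_int:
  fixes y :: "'a::field_char_0 fps"
  assumes y: "fps_nth y 0 = 0"
  shows "fps_to_fls (fps_binomial (of_int e) oo y) = (1 + fps_to_fls y) powi e"
proof -
  have pow: "fps_to_fls (fps_binomial (of_nat j) oo y) = (1 + fps_to_fls y) ^ j" for j
    by (simp add: fps_binomial_of_nat fps_compose_power[OF y, symmetric]
        fps_compose_add_distrib fps_to_fls_power fps_X_fps_compose_startby0[OF y])
  show ?thesis
  proof (cases "e \<ge> 0")
    case True
    then show ?thesis using pow[of "nat e"] by (simp add: power_int_def)
  next
    case False
    define j where "j = nat (- e)"
    have e: "e = - int j" using False by (simp add: j_def)
    have "fps_to_fls (fps_binomial (of_int e) oo y) * (1 + fps_to_fls y) ^ j =
        fps_to_fls ((fps_binomial (of_int e) * fps_binomial (of_nat j)) oo y)"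
      by (simp add: pow[symmetric] fps_compose_mult_distrib[OF y] fls_times_fps_to_fls)
    also have "\<dots> = 1"
      by (simp add: fps_binomial_add_mult[symmetric] e)
    finally have "fps_to_fls (fps_binomial (of_int e) oo y) = inverse ((1 + fps_to_fls y) ^ j)"
      by (metis inverse_unique mult.commute)
    then show ?thesis by (simp only: e power_int_minus power_int_of_nat)
  qed
qed

text \<open>Negating the upper index turns the coefficient into \<open>(- 1) ^ m\<close> times
  \<open>(- p - 1) gchoose m\<close>, so this is the binomial series at \<open>- x\<close>.\<close>

lemma has_sum_negative_binomial_fls:
  fixes x :: "'a::field_char_0 fls"
  assumes "fls_subdegree x > 0"
  shows "((\<lambda>m. (of_int (int m + p) gchoose m) * x ^ m) has_sum (1 - x) powi (- p - 1)) UNIV"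
proof -
  \<comment> \<open>A positive order makes \<open>- x\<close> a power series without constant term,
    so \<open>fls_regpart\<close> loses nothing.\<close>
  define y where "y = fls_regpart (- x)"
  have y0: "fps_nth y 0 = 0" using assms by (simp add: y_def)
  have x: "fps_to_fls y = - x" using assms by (simp add: y_def)
  have eq: "fls_const (fps_nth (fps_binomial (of_int (- p - 1))) m) * fps_to_fls y ^ m =
      (of_int (int m + p) gchoose m) * x ^ m" for m
  proof -
    have "fls_const (of_int (- p - 1) gchoose m :: 'a) = of_int (- p - 1) gchoose m"
      by (rule fls_const_gbinomial[symmetric])
    also have "\<dots> = (- 1) ^ m * (of_int (int m + p) gchoose m)"
      by (subst gbinomial_negated_upper) simp
    finally have "fls_const (of_int (- p - 1) gchoose m :: 'a) * (- x) ^ m =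
        (- 1) ^ m * (of_int (int m + p) gchoose m) * ((- 1) ^ m * x ^ m)"
      by (simp only: power_minus[of x])
    also have "\<dots> = ((- 1) ^ m * (- 1) ^ m) * ((of_int (int m + p) gchoose m) * x ^ m)"
      by (simp only: mult_ac)
    also have "(- 1) ^ m * (- 1) ^ m = (1 :: 'a fls)"
      by (simp add: power_mult_distrib[symmetric])
    finally show ?thesis by (simp only: x fps_binomial_nth mult_1)
  qed
  show ?thesis
    using has_sum_fps_compose[OF y0, of "fps_binomial (of_int (- p - 1))"]
    unfolding eq fps_compose_binomial_of_int[OF y0] by (simp only: x add_uminus_conv_diff)
qed


section \<open>The Q-system in the field of Laurent series\<close>

lemma laurent_0: "laurent 0 = 0"
  by (simp add: Zero_fract_def laurent_Fract)

lemma laurent_inverse: "laurent (inverse x) = inverse (laurent x)"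
proof (cases "x = 0")
  case False
  then have "laurent x * laurent (inverse x) = 1"
    by (simp add: laurent_mult[symmetric] laurent_1)
  then show ?thesis by (simp add: inverse_unique)
qed (simp add: laurent_0)

lemma laurent_divide: "laurent (x / y) = laurent x / laurent y"
  by (simp add: divide_inverse laurent_mult laurent_inverse)

lemma laurent_diff: "laurent (x - y) = laurent x - laurent y"
  using laurent_add[of "x - y" y] by simp

lemma laurent_power: "laurent (x ^ j) = laurent x ^ j"
  by (induction j) (simp_all add: laurent_1 laurent_mult)

lemma laurent_prod: "laurent (\<Prod>i\<in>A. f i) = (\<Prod>i\<in>A. laurent (f i))"
  by (induction A rule: infinite_finite_induct) (simp_all add: laurent_1 laurent_mult)

lemma var'_neq_0: "var' i \<noteq> (0 :: 'a::field_char_0 ratfun')"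
proof -
  have "Poly_Mapping.single (Poly_Mapping.single i 1) (1 :: 'a) \<noteq> 0"
    by (metis lookup_single_eq lookup_zero zero_neq_one)
  then show ?thesis unfolding var'_def Zero_fract_def by (subst eq_fract) (simp_all del: One_nat_def)
qed

lemma laurent_Q_rec:
  "laurent (Q (j + 2) :: 'a::field_char_0 ratfun) =
     ((laurent (Q (j + 1)))\<^sup>2 - 1) / (fls_const (var' (j + 1)) * laurent (Q j))"
  by (simp add: laurent_divide laurent_mult laurent_diff laurent_power laurent_1 laurent_var)

text \<open>The square in the recursion has order \<open>- 2 * (j + 1)\<close> and dominates the 1;
  dividing by a series of order \<open>- j\<close> leaves \<open>- (j + 2)\<close>.\<close>

lemma laurent_Q_subdegree:
  "laurent (Q j :: 'a::field_char_0 ratfun) \<noteq> 0 \<and> fls_subdegree (laurent (Q j :: 'a ratfun)) = - int j"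
proof (induction j rule: induct_nat_012)
  case 0
  then show ?case by (simp add: laurent_1)
next
  case 1
  then show ?case by (simp add: laurent_inverse laurent_var_u)
next
  case (ge2 j)
  let ?L = "\<lambda>i. laurent (Q i :: 'a ratfun)"
  have deg: "fls_subdegree ((?L (j + 1))\<^sup>2 - 1) = - 2 * int (j + 1)"
    using ge2 by (subst fls_subdegree_diff_eq1) (simp_all add: fls_subdegree_pow)
  \<comment> \<open>The zero series has \<open>fls_subdegree\<close> 0 by convention, so a nonzero
    order excludes it.\<close>
  then have nz: "(?L (j + 1))\<^sup>2 - 1 \<noteq> 0"
    by (metis add.commute fls_zero_subdegree int_eq_iff mult_eq_0_iff neg_equal_0_iff_equal
        nat.distinct(1) of_nat_eq_0_iff plus_1_eq_Suc zero_neq_numeral)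
  have eq: "?L (j + 2) * (fls_const (var' (j + 1)) * ?L j) = (?L (j + 1))\<^sup>2 - 1"
    unfolding laurent_Q_rec using ge2 by (simp add: var'_neq_0)
  with nz have nz2: "?L (j + 2) \<noteq> 0" by (metis mult_zero_left)
  have "fls_subdegree (?L (j + 2) * (fls_const (var' (j + 1)) * ?L j)) =
      fls_subdegree (?L (j + 2)) - int j"
    using nz2 ge2 by (simp add: var'_neq_0 del: Q.simps)
  with eq deg have "fls_subdegree (?L (j + 2)) = - int (j + 2)" by simp
  with nz2 show ?case by simp
qed

lemmas laurent_Q_neq_0 = laurent_Q_subdegree[THEN conjunct1]


section \<open>Summing out one variable at a time\<close>

text \<open>Truncated subtraction kills the terms with \<open>t \<le> i\<close>, so the range no
  longer depends on \<open>i\<close> and exponents can be compared termwise.\<close>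

lemma qexp_altdef:
  "qexp k l n m i = int l + (\<Sum>t=1..k. int (t - i) * (2 * int (m t) - int (n t)))"
proof -
  have "(\<Sum>t=1..k. int (t - i) * (2 * int (m t) - int (n t))) =
      (\<Sum>t=i+1..k. int (t - i) * (2 * int (m t) - int (n t)))"
    by (rule sum.mono_neutral_right) auto
  also have "\<dots> = (\<Sum>j=1..k-i. int j * (2 * int (m (i + j)) - int (n (i + j))))"
    by (rule sum.reindex_bij_witness[of _ "\<lambda>j. i + j" "\<lambda>t. t - i"]) auto
  finally show ?thesis by (simp add: qexp_def)
qed

lemma qexp_diff2:
  assumes "j < k"
  shows "qexp k l n m j =
    2 * qexp k l n m (j + 1) - qexp k l n m (j + 2) + 2 * int (m (j + 1)) - int (n (j + 1))"
proof -
  have "qexp k l n m j - 2 * qexp k l n m (j + 1) + qexp k l n m (j + 2) =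
      (\<Sum>t=1..k. (int (t - j) - 2 * int (t - (j + 1)) + int (t - (j + 2))) *
        (2 * int (m t) - int (n t)))"
    unfolding qexp_altdef
    by (simp add: sum.distrib sum_subtractf sum_distrib_left algebra_simps)
  \<comment> \<open>The truncated difference \<open>t - j\<close> is piecewise linear, so its second
    difference is nonzero only at the kink \<open>t = j + 1\<close>.\<close>
  also have "\<dots> = (\<Sum>t=1..k. if t = j + 1 then 2 * int (m t) - int (n t) else 0)"
    by (rule sum.cong) auto
  also have "\<dots> = 2 * int (m (j + 1)) - int (n (j + 1))"
    using assms by (subst sum.delta) auto
  finally show ?thesis by simp
qed

lemma qexp_fun_upd: "j \<le> i \<Longrightarrow> qexp k l n (m(j := v)) i = qexp k l n m i"
  unfolding qexp_altdef by (intro arg_cong2[where f = "(+)"] sum.cong refl) auto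

lemma qexp_last: "k \<le> i \<Longrightarrow> qexp k l n m i = int l"
  by (simp add: qexp_def)

text \<open>Closed form of the telescoped prefactor left by the first \<open>j\<close> summations;
  it is 1 for \<open>j = 0\<close>.\<close>

definition part_coeff :: "(nat \<Rightarrow> nat) \<Rightarrow> nat \<Rightarrow> 'a::field_char_0 ratfun' fls" where
  "part_coeff n j = laurent (Q 1) * laurent (Q j) / laurent (Q (j + 1)) *
     (\<Prod>i=1..j. laurent (Q i) ^ n i / fls_const (var' i))"

definition factor ::
    "nat \<Rightarrow> nat \<Rightarrow> (nat \<Rightarrow> nat) \<Rightarrow> (nat \<Rightarrow> nat) \<Rightarrow> nat \<Rightarrow> 'a::field_char_0 ratfun' fls" where
  "factor k l n m i =
     (of_int (int (m i) + qexp k l n m i) gchoose m i) * fls_const (var' i) powi qexp k l n m i"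

text \<open>
  This is what the summand becomes after summing over \<open>m\<^sub>1, \<dots>, m\<^sub>j\<close>: the initial data
  \<open>Q\<^sub>0 = 1\<close>, \<open>Q\<^sub>1 = 1/u\<close> of the recursion have been replaced by \<open>Q\<^sub>j\<close>, \<open>Q\<^sub>j\<^sub>+\<^sub>1\<close>.
\<close>

definition part_term ::
    "nat \<Rightarrow> nat \<Rightarrow> (nat \<Rightarrow> nat) \<Rightarrow> nat \<Rightarrow> (nat \<Rightarrow> nat) \<Rightarrow> 'a::field_char_0 ratfun' fls" where
  "part_term k l n j m = part_coeff n j *
     (laurent (Q (j + 1)) powi (- qexp k l n m j) * laurent (Q j) powi qexp k l n m (j + 1)) *
     (\<Prod>i=j+1..k. factor k l n m i)"

lemma part_term_0: "part_term k l n 0 = gen_term k l n"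
  by (auto simp: part_term_def part_coeff_def gen_term_def factor_def laurent_1
      laurent_inverse laurent_var_u power_int_minus power_int_inverse)

lemma part_coeff_Suc:
  "(part_coeff n (j + 1) :: 'a::field_char_0 ratfun' fls) = part_coeff n j * laurent (Q (j + 1)) ^ (n (j + 1) + 2) /
     (laurent (Q j) * laurent (Q (j + 2)) * fls_const (var' (j + 1)))"
proof -
  have field: "d * b / c * (X * (b ^ e / w)) = d * a / b * X * b ^ (e + 2) / (a * c * w)"
    if "a \<noteq> 0" "b \<noteq> 0" for a b c d w X :: "'a ratfun' fls" and e
    using that by (simp add: field_simps power2_eq_square)
  have prod: "prod f {1..Suc j} = prod f {1..j} * f (Suc j)" for f :: "nat \<Rightarrow> 'a ratfun' fls"
    by simp
  have "j + 1 + 1 = j + 2" by simp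
  then show ?thesis
    unfolding part_coeff_def
    by (simp only: field[OF laurent_Q_neq_0 laurent_Q_neq_0, symmetric] Suc_eq_plus1[symmetric] prod)
qed

text \<open>\<open>A\<close>, \<open>B\<close>, \<open>C\<close> stand for \<open>Q j\<close>,
  \<open>Q (j + 1)\<close>, \<open>Q (j + 2)\<close>, and \<open>p\<close>, \<open>r\<close> for the
  exponents at \<open>j + 1\<close>, \<open>j + 2\<close>. The recursion makes
  \<open>1 - inverse B ^ 2\<close> a monomial, so only exponents have to be collected.\<close>

lemma summand_powi_identity:
  fixes A B C w :: "'b::field"
  assumes nz: "A \<noteq> 0" "B \<noteq> 0" "C \<noteq> 0" "w \<noteq> 0"
    and rec: "C = (B\<^sup>2 - 1) / (w * A)"
  shows "B powi (r - 2 * p + int d) * (1 - inverse B ^ 2) powi (- p - 1) * (A powi p * w powi p) =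
    B ^ (d + 2) / (A * C * w) * (C powi (- p) * B powi r)"
proof -
  have "1 - inverse B ^ 2 = C * w * A * B powi (- 2)"
    using nz by (simp add: rec field_simps power_int_minus)
  then have "(1 - inverse B ^ 2) powi (- p - 1) =
      C powi (- p - 1) * w powi (- p - 1) * A powi (- p - 1) * B powi (2 * p + 2)"
    by (simp only:) (simp add: power_int_mult_distrib power_int_mult[symmetric] algebra_simps)
  moreover have "B powi (r - 2 * p + int d) * B powi (2 * p + 2) = B ^ (d + 2) * B powi r"
    using nz by (simp add: power_int_add[symmetric] power_int_of_nat[symmetric] algebra_simps)
  moreover have "v powi (- p - 1) * v powi p = inverse v" if "v \<noteq> 0" for v :: 'b
    using that by (simp add: power_int_add[symmetric])
  moreover have "C powi (- p - 1) = C powi (- p) * inverse C"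
    using nz by (simp add: power_int_diff divide_inverse)
  ultimately show ?thesis using nz by (simp add: divide_inverse mult_ac)
qed

text \<open>The summation variable enters only the binomial coefficient and, as
  \<open>- 2 * v\<close>, the exponent of \<open>Q (j + 1)\<close>; the exponents from index
  \<open>j + 1\<close> on do not involve it.\<close>

lemma part_term_has_sum_inner:
  assumes "j < k"
  shows "((\<lambda>v. part_term k l n j (m(j + 1 := v)) :: 'a::field_char_0 ratfun' fls) has_sum
    part_term k l n (j + 1) m) UNIV"
proof -
  let ?L = "\<lambda>i. laurent (Q i :: 'a ratfun)" and ?w = "fls_const (var' (j + 1)) :: 'a ratfun' fls"
  define p r where "p = qexp k l n m (j + 1)" and "r = qexp k l n m (j + 2)"
  define P :: "'a ratfun' fls" where "P = (\<Prod>i=j+2..k. factor k l n m i)"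
  define x where "x = inverse (?L (j + 1)) ^ 2"
  \<comment> \<open>\<open>K\<close> collects all that is independent of \<open>v\<close>; what
    remains is a negative binomial series in \<open>x\<close>.\<close>
  define K where "K = part_coeff n j * (?L (j + 1) powi (r - 2 * p + int (n (j + 1))) *
    (?L j powi p * ?w powi p)) * P"
  have "part_term k l n j (m(j + 1 := v)) = K * ((of_int (int v + p) gchoose v) * x ^ v)" for v
  proof -
    have q: "qexp k l n (m(j + 1 := v)) (j + 1) = p" "qexp k l n (m(j + 1 := v)) (j + 2) = r"
      by (simp_all add: qexp_fun_upd p_def r_def)
    have q0: "- qexp k l n (m(j + 1 := v)) j = (r - 2 * p + int (n (j + 1))) - 2 * int v"
      unfolding qexp_diff2[OF assms, of l n "m(j + 1 := v)"] q by simp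
    have f: "factor k l n (m(j + 1 := v)) (j + 1) = (of_int (int v + p) gchoose v) * ?w powi p"
      by (simp only: factor_def q fun_upd_same)
    have "factor k l n (m(j + 1 := v)) i = factor k l n m i" if "i \<in> {j+2..k}" for i
      using that by (simp add: factor_def qexp_fun_upd)
    then have "(\<Prod>i=j+2..k. factor k l n (m(j + 1 := v)) i) = P"
      unfolding P_def by (intro prod.cong refl)
    moreover have "{j+1..k} = insert (j + 1) {j+2..k}" using assms by auto
    ultimately have pr: "(\<Prod>i=j+1..k. factor k l n (m(j + 1 := v)) i) =
        (of_int (int v + p) gchoose v) * ?w powi p * P"
      using assms by (simp add: f[simplified])
    have "?L (j + 1) powi ((r - 2 * p + int (n (j + 1))) - 2 * int v) =
        ?L (j + 1) powi (r - 2 * p + int (n (j + 1))) * x ^ v"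
      by (simp add: laurent_Q_neq_0 x_def power_int_diff power_int_of_nat power_int_mult power_inverse power_mult
          divide_inverse power_mult_distrib del: Q.simps)
    then show ?thesis
      by (simp only: part_term_def q q0 pr K_def mult_ac)
  qed
  moreover have "K * (1 - x) powi (- p - 1) = part_term k l n (j + 1) m"
  proof -
    have "K * (1 - x) powi (- p - 1) = part_coeff n j *
        (?L (j + 1) powi (r - 2 * p + int (n (j + 1))) * (1 - x) powi (- p - 1) *
          (?L j powi p * ?w powi p)) * P"
      by (simp only: K_def mult_ac)
    also have "\<dots> = part_coeff n (j + 1) * (?L (j + 2) powi (- p) * ?L (j + 1) powi r) * P"
      unfolding x_def part_coeff_Suc
      by (subst summand_powi_identity[OF laurent_Q_neq_0 laurent_Q_neq_0 laurent_Q_neq_0 _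
            laurent_Q_rec]) (simp_all add: var'_neq_0 del: Q.simps)
    finally show ?thesis
      by (simp only: part_term_def p_def r_def P_def add.assoc one_add_one)
  qed
  moreover have "fls_subdegree x > 0"
    by (simp add: x_def fls_subdegree_pow laurent_Q_subdegree del: Q.simps)
  ultimately show ?thesis
    using has_sum_fls_cmult[OF has_sum_negative_binomial_fls[of x p], of K] by simp
qed

text \<open>Splitting off coordinate \<open>j + 1\<close> makes the index set a product, and a sum
  over a product may be taken iteratedly. Convergence is inherited from the full sum at
  \<open>j = 0\<close>.\<close>

lemma part_term_has_sum:
  assumes "j \<le> k"
  shows "(part_term k l n j has_sum (Z k l n :: 'a::field_char_0 ratfun' fls))
    ({j+1..k} \<rightarrow>\<^sub>E UNIV)"
  using assms
proof (induction j)
  case 0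
  show ?case
    using has_sum_infsum[OF gen_term_summable[of k l n]] by (simp only: part_term_0 Z_def add_0)
next
  case (Suc j)
  let ?S = "{j+2..k} \<rightarrow>\<^sub>E (UNIV :: nat set)"
  let ?ins = "\<lambda>(m, v). m(j + 1 := v) :: nat \<Rightarrow> nat"
  have j: "j < k" using Suc.prems by simp
  then have "{j+1..k} = insert (j + 1) {j+2..k}" by auto
  then have img: "?ins ` (?S \<times> UNIV) = {j+1..k} \<rightarrow>\<^sub>E UNIV"
    by (simp only: PiE_insert_eq) (force simp: image_iff)
  have inj: "inj_on ?ins (?S \<times> UNIV)"
    using inj_combinator[of "j + 1" "{j+2..k}" "\<lambda>_. UNIV"]
    by (force simp: inj_on_def)
  have "((\<lambda>x. part_term k l n j (?ins x)) has_sum (Z k l n :: 'a ratfun' fls)) (?S \<times> UNIV)"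
    using Suc.IH j has_sum_reindex[OF inj, of "part_term k l n j :: _ \<Rightarrow> 'a ratfun' fls"]
    by (simp only: img o_def less_imp_le)
  then have "(part_term k l n (j + 1) has_sum (Z k l n :: 'a ratfun' fls)) ?S"
    by (rule has_sum_SigmaD[where f = "\<lambda>x. part_term k l n j (?ins x)"])
      (use part_term_has_sum_inner[OF j] in simp)
  then show ?case by simp
qed

theorem theorem3p5:
  fixes k l :: nat and n :: "nat \<Rightarrow> nat"
  assumes "k \<ge> 1"
  shows "(Z k l n :: 'a::field_char_0 ratfun' fls) =
    laurent (Q 1 * Q k ^ (l + 1) / Q (k + 1) ^ (l + 1) * (\<Prod>i=1..k. Q i ^ n i / var i))"
proof -
  let ?L = "\<lambda>i. laurent (Q i :: 'a ratfun)"
  \<comment> \<open>No index is left at \<open>j = k\<close>, so the extensional functions form a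
    singleton.\<close>
  have "(part_term k l n k has_sum (Z k l n :: 'a ratfun' fls)) {\<lambda>_. undefined}"
    using part_term_has_sum[of k k l n] by simp
  then have "Z k l n = (part_term k l n k (\<lambda>_. undefined) :: 'a ratfun' fls)"
    using has_sum_finite[of "{\<lambda>_. undefined}" "part_term k l n k"]
    by (auto dest: has_sum_unique)
  \<comment> \<open>The exponents at \<open>k\<close> and \<open>k + 1\<close> are both
    \<open>l\<close>, which gives the powers beyond those in \<open>part_coeff\<close>.\<close>
  also have "\<dots> = part_coeff n k * (?L (k + 1) powi (- int l) * ?L k powi int l)"
    by (simp add: part_term_def qexp_last del: Q.simps)
  also have "\<dots> = ?L 1 * ?L k ^ (l + 1) / ?L (k + 1) ^ (l + 1) *
      (\<Prod>i=1..k. ?L i ^ n i / fls_const (var' i))"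
    unfolding part_coeff_def
    by (simp only: power_int_minus divide_inverse power_int_of_nat power_add power_one_right
        inverse_mult_distrib mult_ac)
  finally show ?thesis
    by (simp only: laurent_mult laurent_divide laurent_power laurent_prod laurent_var)
qed

end
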